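(* Let $\alpha=(\alpha_n)_{n\in\mathbb N}$ be a positive, strictly increasing sequence with $\alpha_n\to\infty$. The following conditions are equivalent. (i) $\sup_{n\in\mathbb N}\frac{\log n}{\alpha_n}<\infty$, i.e. $E_\alpha$ is nuclear. (ii) The Cesàro operator $\mathsf C\in\mathcal L(E_\alpha)$ is invertible, i.e. $0\in\rho(\mathsf C;E_\alpha)$.
   Context: $\mathbb N=\{1,2,3,\dots\}$. For a strictly positive sequence $w$ on $\mathbb N$, $c_0(w)=\{x\in\mathbb C^{\mathbb N}: \lim_{n\to\infty} w(n)|x_n|=0\}$, a Banach space with norm $\sup_n w(n)|x_n|$. Given $\alpha$, fix a strictly increasing sequence $(s_k)_{k\in\mathbb N}\subset(1,\infty)$ with $s_k\to\infty$ and put $v_k(n):=s_k^{-\alpha_n}$ for $k,n\in\mathbb N$. Define $E_\alpha:=\mathrm{ind}_k\, c_0(v_k)$, i.e. $E_\alpha=\bigcup_k c_0(v_k)\subseteq\mathbb C^{\mathbb N}$ endowed with the finest locally convex Hausdorff topology making all inclusions $c_0(v_k)\hookrightarrow E_\alpha$ continuous; $E_\alpha$ does not depend on the choice of $(s_k)$. It is known that $E_\alpha$ is nuclear if and only if $\sup_n\frac{\log n}{\alpha_n}<\infty$. The Cesàro operator is $\mathsf Cx=\left(\frac{x_1+\dots+x_n}{n}\right)_{n\in\mathbb N}$, and it belongs to $\mathcal L(E_\alpha)$, where $\mathcal L(X)$ denotes the space of continuous linear operators from $X$ into itself. For $T\in\mathcal L(X)$, the resolvent set $\rho(T;X)$ is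 the set of $\lambda\in\mathbb C$ such that $(\lambda I-T)^{-1}$ exists in $\mathcal L(X)$. *)

theory Defs
  imports "HOL-Analysis.Analysis" "HOL-Library.Function_Algebras"
begin

text \<open>
  The space of all complex sequences over the index set 1, 2, 3, ... is modelled by the type
  \<^typ>\<open>nat \<Rightarrow> complex\<close> with all indices shifted by one: the entry with index n + 1 of a sequence x
  is \<open>x n\<close>. The same shift applies to weights, to the exponent sequence \<open>\<alpha>\<close> and to \<open>s\<close>.
\<close>

type_synonym cseq = "nat \<Rightarrow> complex"

definition seq_scale :: "complex \<Rightarrow> cseq \<Rightarrow> cseq" where
  "seq_scale c x = (\<lambda>n. c * x n)"

interpretation seq: vector_space seq_scale
  by standard (auto simp: seq_scale_def algebra_simps fun_eq_iff)


subsection \<open>Locally convex Hausdorff topologies on sequence spaces\<close>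

definition seq_convex :: "cseq set \<Rightarrow> bool" where
  "seq_convex V \<longleftrightarrow>
     (\<forall>x\<in>V. \<forall>y\<in>V. \<forall>t\<in>{0..1::real}.
        seq_scale (of_real (1 - t)) x + seq_scale (of_real t) y \<in> V)"

definition lc_hausdorff :: "cseq topology \<Rightarrow> bool" where
  "lc_hausdorff T \<longleftrightarrow>
     seq.subspace (topspace T) \<and>
     continuous_map (prod_topology T T) T (\<lambda>(x, y). x + y) \<and>
     continuous_map (prod_topology (euclidean :: complex topology) T) T (\<lambda>(c, x). seq_scale c x) \<and>
     (\<forall>U. openin T U \<and> 0 \<in> U \<longrightarrow> (\<exists>V. openin T V \<and> seq_convex V \<and> 0 \<in> V \<and> V \<subseteq> U)) \<and>
     Hausdorff_space T"


subsection \<open>Locally convex inductive limits\<close>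

definition step_compatible :: "(nat \<Rightarrow> cseq topology) \<Rightarrow> cseq topology \<Rightarrow> bool" where
  "step_compatible X T \<longleftrightarrow>
     topspace T = (\<Union>k. topspace (X k)) \<and> lc_hausdorff T \<and>
     (\<forall>k. continuous_map (X k) T (\<lambda>x. x))"

definition is_ind_limit :: "(nat \<Rightarrow> cseq topology) \<Rightarrow> cseq topology \<Rightarrow> bool" where
  "is_ind_limit X T \<longleftrightarrow>
     step_compatible X T \<and>
     (\<forall>T'. step_compatible X T' \<longrightarrow> (\<forall>U. openin T' U \<longrightarrow> openin T U))"

definition ind_limit :: "(nat \<Rightarrow> cseq topology) \<Rightarrow> cseq topology" where
  "ind_limit X = (THE T. is_ind_limit X T)"


subsection \<open>Weighted null sequences and the space \<open>E\<^sub>\<alpha>\<close>\<close>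

definition c0 :: "(nat \<Rightarrow> real) \<Rightarrow> cseq set" where
  "c0 w = {x. (\<lambda>n. w n * norm (x n)) \<longlonglongrightarrow> 0}"

definition c0_norm :: "(nat \<Rightarrow> real) \<Rightarrow> cseq \<Rightarrow> real" where
  "c0_norm w x = (SUP n. w n * norm (x n))"

text \<open>
  The locale \<^locale>\<open>Metric_space\<close> wants the distance to be nonnegative on the whole type, which the
  supremum of an unbounded set does not guarantee; hence the value 0 outside the space.
\<close>

definition c0_dist :: "(nat \<Rightarrow> real) \<Rightarrow> cseq \<Rightarrow> cseq \<Rightarrow> real" where
  "c0_dist w x y = (if x \<in> c0 w \<and> y \<in> c0 w then c0_norm w (x - y) else 0)"

definition c0_topology :: "(nat \<Rightarrow> real) \<Rightarrow> cseq topology" where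
  "c0_topology w = Metric_space.mtopology (c0 w) (c0_dist w)"

definition weight :: "(nat \<Rightarrow> real) \<Rightarrow> (nat \<Rightarrow> real) \<Rightarrow> nat \<Rightarrow> nat \<Rightarrow> real" where
  "weight \<alpha> s k n = s k powr (- \<alpha> n)"

definition E_space :: "(nat \<Rightarrow> real) \<Rightarrow> (nat \<Rightarrow> real) \<Rightarrow> cseq topology" where
  "E_space \<alpha> s = ind_limit (\<lambda>k. c0_topology (weight \<alpha> s k))"


subsection \<open>Continuous operators and the resolvent set\<close>

text \<open>
  Operators are total functions on sequences of which only the restriction to the underlying
  space matters.
\<close>

definition cont_linear_ops :: "cseq topology \<Rightarrow> (cseq \<Rightarrow> cseq) set" where
  "cont_linear_ops X =
     {T. continuous_map X X T \<and>
         (\<forall>x\<in>topspace X. \<forall>y\<in>topspace X. T (x + y) = T x + T y) \<and>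
         (\<forall>c. \<forall>x\<in>topspace X. T (seq_scale c x) = seq_scale c (T x))}"

definition resolvent_set :: "(cseq \<Rightarrow> cseq) \<Rightarrow> cseq topology \<Rightarrow> complex set" where
  "resolvent_set T X =
     {\<mu>. \<exists>R\<in>cont_linear_ops X. \<forall>x\<in>topspace X.
          R (seq_scale \<mu> x - T x) = x \<and> seq_scale \<mu> (R x) - T (R x) = x}"

definition cesaro :: "cseq \<Rightarrow> cseq" where
  "cesaro x = (\<lambda>n. (\<Sum>i\<le>n. x i) / of_nat (Suc n))"


subsection \<open>The definitions are meaningful\<close>

text \<open>The distance used for \<^const>\<open>c0_topology\<close> is a metric.\<close>

lemma c0_bdd:
  assumes "x \<in> c0 w" shows "bdd_above (range (\<lambda>n. w n * norm (x n)))"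
proof -
  have "Bseq (\<lambda>n. w n * norm (x n))"
    using assms by (intro convergent_imp_Bseq convergentI) (auto simp: c0_def)
  then show ?thesis by (rule Bseq_bdd_above) 
qed

lemma c0_subspace:
  assumes "\<And>n. w n > 0" shows "seq.subspace (c0 w)"
proof (rule seq.subspaceI)
  show "0 \<in> c0 w" by (simp add: c0_def)
next
  fix x y assume "x \<in> c0 w" "y \<in> c0 w"
  then have "(\<lambda>n. w n * norm (x n) + w n * norm (y n)) \<longlonglongrightarrow> 0"
    unfolding c0_def using tendsto_add by fastforce
  then have "(\<lambda>n. w n * norm (x n + y n)) \<longlonglongrightarrow> 0"
  proof (rule Lim_null_comparison[rotated], intro always_eventually allI)
    fix n
    have "w n * norm (x n + y n) \<le> w n * (norm (x n) + norm (y n))"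
      using assms[of n] by (intro mult_left_mono norm_triangle_ineq) auto
    then show "norm (w n * norm (x n + y n)) \<le> w n * norm (x n) + w n * norm (y n)"
      using assms[of n] by (simp add: algebra_simps abs_mult)
  qed
  then show "x + y \<in> c0 w" by (simp add: c0_def)
next
  fix c :: complex and x assume "x \<in> c0 w"
  then have "(\<lambda>n. norm c * (w n * norm (x n))) \<longlonglongrightarrow> 0"
    unfolding c0_def using tendsto_mult_right_zero by blast
  then show "seq_scale c x \<in> c0 w"
    by (simp add: c0_def seq_scale_def norm_mult mult_ac)
qed

lemma c0_le_norm:
  assumes "x \<in> c0 w" shows "w n * norm (x n) \<le> c0_norm w x"
  unfolding c0_norm_def using c0_bdd[OF assms] by (intro cSUP_upper) auto

lemma Metric_space_c0:
  assumes "\<And>n. w n > 0" shows "Metric_space (c0 w) (c0_dist w)"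
proof
  show "0 \<le> c0_dist w x y" for x y
  proof (cases "x \<in> c0 w \<and> y \<in> c0 w")
    case True
    have "0 \<le> w 0 * norm ((x - y) 0)" using assms[of 0] by simp
    also have "\<dots> \<le> c0_norm w (x - y)"
      using True c0_subspace[OF assms] by (intro c0_le_norm seq.subspace_diff) auto
    finally show ?thesis using True by (simp add: c0_dist_def)
  qed (auto simp: c0_dist_def)
  show "c0_dist w x y = c0_dist w y x" for x y
    unfolding c0_norm_def c0_dist_def by (simp add: norm_minus_commute)
  show "(c0_dist w x y = 0) = (x = y)" if "x \<in> c0 w" "y \<in> c0 w" for x y
  proof
    assume "c0_dist w x y = 0"
    with that have *: "c0_norm w (x - y) = 0" by (simp add: c0_dist_def)
    have "w n * norm ((x - y) n) \<le> 0" for n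
      unfolding *[symmetric]
      using that c0_subspace[OF assms] by (intro c0_le_norm seq.subspace_diff) auto
    then have "norm ((x - y) n) \<le> 0" for n
      using assms[of n] by (metis mult_le_0_iff not_less)
    then show "x = y" by (auto simp: fun_eq_iff)
  qed (simp add: c0_norm_def c0_dist_def)
  fix x y z assume that: "x \<in> c0 w" "y \<in> c0 w" "z \<in> c0 w"
  have "c0_norm w (x - z) \<le> c0_norm w (x - y) + c0_norm w (y - z)"
    unfolding c0_norm_def[of w "x - z"]
  proof (rule cSUP_least)
    fix n
    have "w n * norm ((x - z) n) \<le> w n * (norm ((x - y) n) + norm ((y - z) n))"
      using assms[of n] norm_triangle_ineq[of "(x - y) n" "(y - z) n"]
      by (intro mult_left_mono) auto
    also have "\<dots> \<le> c0_norm w (x - y) + c0_norm w (y - z)"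
      unfolding distrib_left
      using that c0_subspace[OF assms] by (intro add_mono c0_le_norm seq.subspace_diff) auto
    finally show "w n * norm ((x - z) n) \<le> c0_norm w (x - y) + c0_norm w (y - z)" .
  qed simp
  with that show "c0_dist w x z \<le> c0_dist w x y + c0_dist w y z" by (simp add: c0_dist_def)
qed

text \<open>
  As soon as one compatible topology exists, their supremum is the finest one, so that
  \<^const>\<open>ind_limit\<close> is well defined.
\<close>

lemma is_ind_limit_unique: "is_ind_limit X T \<Longrightarrow> is_ind_limit X T' \<Longrightarrow> T = T'"
  unfolding is_ind_limit_def by (auto simp: topology_eq)

lemma ind_limit_exists:
  assumes T0: "step_compatible X T0" shows "\<exists>T. is_ind_limit X T"
proof -
  define G where "G = {U. \<exists>T. step_compatible X T \<and> openin T U}"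
  define S where "S = topology_generated_by G"
  define E where "E = (\<Union>k. topspace (X k))"
  have top: "topspace T = E" if "step_compatible X T" for T
    using that by (simp add: step_compatible_def E_def)
  have fine: "openin S U" if "step_compatible X T" "openin T U" for T U
    unfolding S_def by (rule topology_generated_by_Basis) (use that in \<open>auto simp: G_def\<close>)
  have UG: "\<Union>G = E"
  proof
    show "\<Union>G \<subseteq> E" unfolding G_def using top openin_subset by fastforce
    have "E \<in> G" unfolding G_def using T0 top[OF T0] openin_topspace by blast
    then show "E \<subseteq> \<Union>G" by blast
  qed
  then have topS: "topspace S = E" by (simp add: S_def)
  have idc: "continuous_map S T (\<lambda>x. x)" if "step_compatible X T" for T
    unfolding continuous_map using fine[OF that] top[OF that] topS
    by (auto simp: Int_absorb1 openin_subset dest: openin_subset)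
       (metis Collect_conj_eq Collect_mem_eq Int_absorb1 openin_subset that top)
  have into: "continuous_map Z S f"
    if "\<And>T. step_compatible X T \<Longrightarrow> continuous_map Z T f" for Z :: "'z topology" and f
    unfolding S_def
  proof (rule continuous_on_generated_topo)
    fix U assume "U \<in> G"
    then obtain T where "step_compatible X T" "openin T U" by (auto simp: G_def)
    then have "openin Z {x \<in> topspace Z. f x \<in> U}"
      using that openin_continuous_map_preimage by blast
    moreover have "{x \<in> topspace Z. f x \<in> U} = f -` U \<inter> topspace Z" by auto
    ultimately show "openin Z (f -` U \<inter> topspace Z)" by simp
  next
    show "f ` topspace Z \<subseteq> \<Union>G"
      using that[OF T0] top[OF T0] UG by (auto simp: continuous_map)
  qed
  have conv: "\<exists>V. openin S V \<and> seq_convex V \<and> 0 \<in> V \<and> V \<subseteq> U" 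
    if "generate_topology_on G U" "0 \<in> U" for U
    using that
  proof (induction rule: generate_topology_on.induct)
    case (Int A B)
    then obtain V W where "openin S V" "seq_convex V" "0 \<in> V" "V \<subseteq> A"
      "openin S W" "seq_convex W" "0 \<in> W" "W \<subseteq> B" by blast
    moreover from this have "openin S (V \<inter> W)" "seq_convex (V \<inter> W)"
      unfolding seq_convex_def by blast+
    ultimately show ?case by blast
  next
    case (UN K)
    then show ?case by (meson UnionE Union_upper order.trans)
  next
    case (Basis A)
    then obtain T where T: "step_compatible X T" "openin T A" by (auto simp: G_def)
    then obtain V where "openin T V" "seq_convex V" "0 \<in> V" "V \<subseteq> A"
      using Basis unfolding step_compatible_def lc_hausdorff_def by blast
    then show ?case using fine[OF T(1)] by blast
  qed auto
  have "lc_hausdorff S"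
    unfolding lc_hausdorff_def
  proof (intro conjI allI impI)
    show "seq.subspace (topspace S)"
      using T0 top[OF T0] topS by (auto simp: step_compatible_def lc_hausdorff_def)
    show "continuous_map (prod_topology S S) S (\<lambda>(x, y). x + y)"
    proof (rule into)
      fix T assume T: "step_compatible X T"
      then have 1: "continuous_map (prod_topology T T) T (\<lambda>(x, y). x + y)"
        by (simp add: step_compatible_def lc_hausdorff_def)
      have "continuous_map (prod_topology S S) (prod_topology T T) (\<lambda>z. (fst z, snd z))"
        by (intro continuous_map_pairedI continuous_map_compose[OF continuous_map_fst idc[OF T], unfolded o_def]
            continuous_map_compose[OF continuous_map_snd idc[OF T], unfolded o_def])
      from continuous_map_compose[OF this 1]
      show "continuous_map (prod_topology S S) T (\<lambda>(x, y). x + y)"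
        by (simp add: o_def)
    qed
    show "continuous_map (prod_topology euclidean S) S (\<lambda>(c, x). seq_scale c x)"
    proof (rule into)
      fix T assume T: "step_compatible X T"
      then have 1: "continuous_map (prod_topology euclidean T) T (\<lambda>(c, x). seq_scale c x)"
        by (simp add: step_compatible_def lc_hausdorff_def)
      have "continuous_map (prod_topology euclidean S) (prod_topology euclidean T) (\<lambda>z. (fst z, snd z))"
        by (intro continuous_map_pairedI continuous_map_fst
            continuous_map_compose[OF continuous_map_snd idc[OF T], unfolded o_def])
      from continuous_map_compose[OF this 1]
      show "continuous_map (prod_topology euclidean S) T (\<lambda>(c, x). seq_scale c x)"
        by (simp add: o_def)
    qed
    show "\<exists>V. openin S V \<and> seq_convex V \<and> 0 \<in> V \<and> V \<subseteq> U" if "openin S U \<and> 0 \<in> U" for U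
      using that conv unfolding S_def by (simp add: openin_topology_generated_by_iff)
    have "Hausdorff_space T0" using T0 by (simp add: step_compatible_def lc_hausdorff_def)
    then show "Hausdorff_space S"
      unfolding Hausdorff_space_def top[OF T0] topS using fine[OF T0] by metis
  qed
  moreover have "continuous_map (X k) S (\<lambda>x. x)" for k
    by (rule into) (simp add: step_compatible_def)
  ultimately have "step_compatible X S"
    using topS by (simp add: step_compatible_def E_def)
  then have "is_ind_limit X S" unfolding is_ind_limit_def using fine by blast
  then show ?thesis ..
qed

lemma is_ind_limit_ind_limit:
  assumes "step_compatible X T" shows "is_ind_limit X (ind_limit X)"
  unfolding ind_limit_def
  using ind_limit_exists[OF assms] is_ind_limit_unique by (metis theI)

text \<open>
  For the spaces considered here the topology of coordinatewise convergence is compatible.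
\<close>

lemma lc_hausdorff_coordinatewise:
  assumes "seq.subspace E" shows "lc_hausdorff (top_of_set E)"
  unfolding lc_hausdorff_def
proof (intro conjI allI impI)
  show "seq.subspace (topspace (top_of_set E))" using assms by simp
  have "continuous_on (E \<times> E) (\<lambda>z. fst z + snd z)"
    unfolding plus_fun_def
    by (intro continuous_on_coordinatewise_then_product continuous_intros
        continuous_on_product_then_coordinatewise[OF continuous_on_fst[OF continuous_on_id]]
        continuous_on_product_then_coordinatewise[OF continuous_on_snd[OF continuous_on_id]])
  then show "continuous_map (prod_topology (top_of_set E) (top_of_set E)) (top_of_set E) (\<lambda>(x, y). x + y)"
    using seq.subspace_add[OF assms]
    by (auto simp: prod_topology_subtopology subtopology_subtopology
        continuous_map_in_subtopology case_prod_unfold Times_Int_Times)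
  have "continuous_on (UNIV \<times> E) (\<lambda>z. seq_scale (fst z) (snd z))"
    unfolding seq_scale_def
    by (intro continuous_on_coordinatewise_then_product continuous_intros
        continuous_on_product_then_coordinatewise[OF continuous_on_snd[OF continuous_on_id]])
  then show "continuous_map (prod_topology euclidean (top_of_set E)) (top_of_set E) (\<lambda>(c, x). seq_scale c x)"
    using seq.subspace_scale[OF assms]
    by (auto simp: prod_topology_subtopology continuous_map_in_subtopology case_prod_unfold)
  show "Hausdorff_space (top_of_set E)"
    by (intro Hausdorff_space_subtopology) simp
  fix U assume "openin (top_of_set E) U \<and> 0 \<in> U"
  then obtain W where W: "open W" "U = E \<inter> W" "0 \<in> W" "0 \<in> E" by (auto simp: openin_open)
  then obtain Y where Y: "0 \<in> Pi\<^sub>E UNIV Y" "\<And>i. open (Y i)" "finite {i. Y i \<noteq> UNIV}" "Pi\<^sub>E UNIV Y \<subseteq> W"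
  proof -
    have "openin (product_topology (\<lambda>_. euclidean) UNIV) W"
      using W(1) by (simp add: euclidean_product_topology)
    from product_topology_open_contains_basis[OF this W(3)]
    obtain Y where "0 \<in> Pi\<^sub>E UNIV Y" "\<forall>i. open (Y i)" "finite {i. Y i \<noteq> UNIV}" "Pi\<^sub>E UNIV Y \<subseteq> W"
      unfolding open_openin[symmetric] topspace_euclidean by blast
    then show ?thesis using that by blast
  qed
  have "\<exists>Z. open Z \<and> convex Z \<and> 0 \<in> Z \<and> Z \<subseteq> Y i \<and> (Y i = UNIV \<longrightarrow> Z = UNIV)" for i
  proof (cases "Y i = UNIV")
    case False
    have "0 \<in> Y i" using Y(1) by (auto simp: PiE_iff)
    with Y(2) obtain e where "e > 0" "ball 0 e \<subseteq> Y i" using open_contains_ball by metis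
    with False show ?thesis by (intro exI[of _ "ball 0 e"]) auto
  qed (intro exI[of _ UNIV]; simp)
  then obtain Z where Z: "\<And>i. open (Z i)" "\<And>i. convex (Z i)" "\<And>i. 0 \<in> Z i" "\<And>i. Z i \<subseteq> Y i"
     "\<And>i. Y i = UNIV \<Longrightarrow> Z i = UNIV" by metis
  have "finite {i. Z i \<noteq> UNIV}"
    by (rule finite_subset[OF _ Y(3)]) (use Z(5) in auto)
  then have oZ: "open (Pi\<^sub>E UNIV Z)" using Z(1) by (intro open_PiE) auto
  have "seq_convex (E \<inter> Pi\<^sub>E UNIV Z)"
    unfolding seq_convex_def
  proof (intro ballI IntI)
    fix x y t assume *: "x \<in> E \<inter> Pi\<^sub>E UNIV Z" "y \<in> E \<inter> Pi\<^sub>E UNIV Z" "t \<in> {0..1::real}"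
    show "seq_scale (of_real (1 - t)) x + seq_scale (of_real t) y \<in> E"
      using * by (intro seq.subspace_add[OF assms] seq.subspace_scale[OF assms]) auto
    have "(1 - t) *\<^sub>R x i + t *\<^sub>R y i \<in> Z i" for i
      using * convexD[OF Z(2), of "x i" i "y i" "1 - t" t] by (auto simp: PiE_iff)
    then show "seq_scale (of_real (1 - t)) x + seq_scale (of_real t) y \<in> Pi\<^sub>E UNIV Z"
      by (simp add: PiE_iff seq_scale_def scaleR_conv_of_real)
  qed
  moreover have "openin (top_of_set E) (E \<inter> Pi\<^sub>E UNIV Z)" using oZ by auto
  moreover have "E \<inter> Pi\<^sub>E UNIV Z \<subseteq> U" using W(2) Y(4) Z(4) by (fastforce simp: PiE_iff)
  ultimately show "\<exists>V. openin (top_of_set E) V \<and> seq_convex V \<and> 0 \<in> V \<and> V \<subseteq> U"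
    using Z(3) W(4) by (intro exI[of _ "E \<inter> Pi\<^sub>E UNIV Z"]) (auto simp: PiE_iff)
qed

lemma topspace_c0_topology:
  assumes "\<And>n. w n > 0" shows "topspace (c0_topology w) = c0 w"
  unfolding c0_topology_def by (rule Metric_space.topspace_mtopology[OF Metric_space_c0[OF assms]])

lemma continuous_c0_coordinate:
  assumes "\<And>n. w n > 0" shows "continuous_map (c0_topology w) euclidean (\<lambda>x. x i)"
proof -
  interpret M: Metric_space "c0 w" "c0_dist w"
    by (rule Metric_space_c0[OF assms])
  have "continuous_map M.mtopology (Met_TC.mtopology :: complex topology) (\<lambda>x. x i)"
  proof (subst Metric_space.metric_continuous_map[OF M.Metric_space_axioms Met_TC.Metric_space_axioms],
      intro conjI ballI allI impI)
    fix a and e :: real assume a: "a \<in> c0 w" and "e > 0"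
    have "dist (a i) (x i) < e" if "x \<in> c0 w" "c0_dist w a x < w i * e" for x
    proof -
      have "w i * norm ((a - x) i) \<le> c0_norm w (a - x)"
        using a that c0_subspace[OF assms] by (intro c0_le_norm seq.subspace_diff) auto
      also have "\<dots> < w i * e" using that a by (simp add: c0_dist_def)
      finally show ?thesis using assms[of i] by (simp add: dist_norm)
    qed
    then show "\<exists>d>0. \<forall>x. x \<in> c0 w \<and> c0_dist w a x < d \<longrightarrow> dist (a i) (x i) < e"
      using \<open>e > 0\<close> assms[of i] by (intro exI[of _ "w i * e"]) auto
  qed auto
  then show ?thesis by (simp add: c0_topology_def)
qed

theorem E_space_is_ind_limit:
  assumes \<alpha>: "\<And>n. 0 < \<alpha> n" and s: "strict_mono s" "\<And>k. 1 < s k"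
  shows "is_ind_limit (\<lambda>k. c0_topology (weight \<alpha> s k)) (E_space \<alpha> s)"
    and "topspace (E_space \<alpha> s) = (\<Union>k. c0 (weight \<alpha> s k))"
proof -
  have pos: "weight \<alpha> s k n > 0" for k n
    using s(2)[of k] by (simp add: weight_def)
  have mono: "c0 (weight \<alpha> s j) \<subseteq> c0 (weight \<alpha> s k)" if "j \<le> k" for j k
  proof
    fix x assume "x \<in> c0 (weight \<alpha> s j)"
    then have *: "(\<lambda>n. weight \<alpha> s j n * norm (x n)) \<longlonglongrightarrow> 0" by (simp add: c0_def)
    have "weight \<alpha> s k n \<le> weight \<alpha> s j n" for n
      unfolding weight_def using \<alpha>[of n] s(2)[of j] strict_mono_leD[OF s(1) that]
      by (intro powr_mono2') auto
    then have "(\<lambda>n. weight \<alpha> s k n * norm (x n)) \<longlonglongrightarrow> 0"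
      using pos by (intro Lim_null_comparison[OF always_eventually *])
         (auto simp: abs_mult less_imp_le intro!: mult_right_mono)
    then show "x \<in> c0 (weight \<alpha> s k)" by (simp add: c0_def)
  qed
  define E where "E = (\<Union>k. c0 (weight \<alpha> s k))"
  have sub: "seq.subspace (c0 (weight \<alpha> s k))" for k
    by (rule c0_subspace) (rule pos)
  have "seq.subspace E"
  proof (rule seq.subspaceI)
    show "0 \<in> E" unfolding E_def using seq.subspace_0[OF sub] by blast
  next
    fix x y assume "x \<in> E" "y \<in> E"
    then obtain j k where "x \<in> c0 (weight \<alpha> s j)" "y \<in> c0 (weight \<alpha> s k)" by (auto simp: E_def)
    then have "x \<in> c0 (weight \<alpha> s (max j k))" "y \<in> c0 (weight \<alpha> s (max j k))"
      using mono[of j "max j k"] mono[of k "max j k"] by auto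
    then show "x + y \<in> E" unfolding E_def using seq.subspace_add[OF sub] by blast
  next
    fix c :: complex and x assume "x \<in> E"
    then show "seq_scale c x \<in> E" unfolding E_def using seq.subspace_scale[OF sub] by blast
  qed
  then have lc: "lc_hausdorff (top_of_set E)" by (rule lc_hausdorff_coordinatewise)
  have "continuous_map (c0_topology (weight \<alpha> s k)) (top_of_set E) (\<lambda>x. x)" for k
  proof -
    have "continuous_map (c0_topology (weight \<alpha> s k)) euclidean (\<lambda>x. x)"
      unfolding euclidean_product_topology[symmetric] continuous_map_componentwise_UNIV
      using continuous_c0_coordinate[of "weight \<alpha> s k", OF pos] by blast
    then show ?thesis
      by (auto simp: continuous_map_in_subtopology topspace_c0_topology[OF pos] E_def)
  qed
  with lc have "step_compatible (\<lambda>k. c0_topology (weight \<alpha> s k)) (top_of_set E)"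
    by (simp add: step_compatible_def topspace_c0_topology[OF pos] E_def)
  then show *: "is_ind_limit (\<lambda>k. c0_topology (weight \<alpha> s k)) (E_space \<alpha> s)"
    unfolding E_space_def by (rule is_ind_limit_ind_limit)
  then show "topspace (E_space \<alpha> s) = (\<Union>k. c0 (weight \<alpha> s k))"
    by (simp add: is_ind_limit_def step_compatible_def topspace_c0_topology[OF pos])
qed

end

theory Submission
  imports Defs
begin

text \<open>
  The Cesaro operator is a bijection of the space of all sequences; its inverse
  \<open>inv_cesaro\<close> is the weighted difference that sends y to the sequence with entries \<open>n y\<^sub>n - (n - 1) y\<^sub>n\<^sub>-\<^sub>1\<close>
  (counting from 1). Invertibility on \<open>E\<^sub>\<alpha>\<close> is therefore the question whether
  \<open>inv_cesaro\<close> is a continuous operator of \<open>E\<^sub>\<alpha>\<close>, that is, whether multiplication by n is harmless there.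

  If \<open>ln n / \<alpha>\<^sub>n \<le> M\<close> then \<open>n \<le> (exp M) powr \<alpha>\<^sub>n\<close>, so the factor n is absorbed by
  passing from the weight with base \<open>s\<^sub>k\<close> to one with base at least \<open>exp M * s\<^sub>k\<close>. Hence
  \<open>inv_cesaro\<close> maps every step of the inductive limit boundedly into a later one, which is enough for
  continuity (\<open>coechelon.inv_cesaro_op\<close>). The Cesaro operator itself is continuous
  because the weights decrease in n (\<open>coechelon.cesaro_op\<close>).

  Conversely, the bounded sequence \<open>(-1)\<^sup>n\<close> lies in \<open>E\<^sub>\<alpha>\<close>, and its preimage under the
  Cesaro operator has modulus of order n. If that preimage lies in \<open>E\<^sub>\<alpha>\<close> as well, then n is
  at most a constant times \<open>s\<^sub>k powr \<alpha>\<^sub>n\<close> for some k, and taking logarithms bounds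
  \<open>ln n / \<alpha>\<^sub>n\<close> (\<open>coechelon.inv_cesaro_invariant_imp_bounded\<close>).
\<close>

section \<open>Linear maps out of an inductive limit\<close>

text \<open>
  The coarsest topology that refines \<open>S\<close> and makes \<open>T\<close> continuous from it into \<open>S\<close> is again
  locally convex and Hausdorff. It is obtained as the pullback of \<open>S \<times> S\<close> along the graph map of
  \<open>T\<close>, so continuity into it can be tested on the two components.
\<close>

lemma lc_hausdorff_graph_topology:
  fixes T :: "cseq \<Rightarrow> cseq"
  assumes S: "lc_hausdorff S" and T: "Vector_Spaces.linear seq_scale seq_scale T"
    and maps: "T \<in> topspace S \<rightarrow> topspace S"
  defines "P \<equiv> pullback_topology (topspace S) (\<lambda>x. (x, T x)) (prod_topology S S)"
  shows "lc_hausdorff P" and "topspace P = topspace S" and "continuous_map P S T"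
    and "\<And>U. openin S U \<Longrightarrow> openin P U"
    and "\<And>Z f. continuous_map Z S f \<Longrightarrow> continuous_map Z S (\<lambda>z. T (f z)) \<Longrightarrow> continuous_map Z P f"
proof -
  have add: "T (x + y) = T x + T y" and scale: "T (seq_scale c x) = seq_scale c (T x)" for c x y
    using T by (simp_all add: Vector_Spaces.linear_iff)
  show top: "topspace P = topspace S"
    unfolding P_def topspace_pullback_topology using maps by auto
  show into: "continuous_map Z P f"
    if "continuous_map Z S f" "continuous_map Z S (\<lambda>z. T (f z))" for Z :: "'z topology" and f
    unfolding P_def
  proof (rule continuous_map_pullback')
    show "continuous_map Z (prod_topology S S) ((\<lambda>x. (x, T x)) \<circ> f)"
      unfolding o_def using that by (intro continuous_map_pairedI)
    show "topspace Z \<subseteq> f -` topspace S"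
      using that(1) by (auto simp: continuous_map)
  qed
  have graph: "continuous_map P S (g \<circ> (\<lambda>x. (x, T x)))"
    if "continuous_map (prod_topology S S) S g" for g
    unfolding P_def using that by (rule continuous_map_pullback)
  have cid: "continuous_map P S (\<lambda>x. x)"
    using graph[OF continuous_map_fst] by (simp add: o_def)
  show cT: "continuous_map P S T"
    using graph[OF continuous_map_snd] by (simp add: o_def)
  show finer: "openin P U" if "openin S U" for U
  proof -
    have "openin P {x \<in> topspace P. x \<in> U}"
      using openin_continuous_map_preimage[OF cid that] .
    moreover have "{x \<in> topspace P. x \<in> U} = U"
      using openin_subset[OF that] top by auto
    ultimately show ?thesis by simp
  qed
  have Sadd: "continuous_map (prod_topology S S) S (\<lambda>(x, y). x + y)"
    and Sscale: "continuous_map (prod_topology (euclidean :: complex topology) S) S (\<lambda>(c, x). seq_scale c x)"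
    using S by (simp_all add: lc_hausdorff_def)
  have add': "continuous_map (prod_topology P P) S (\<lambda>z. g (fst z) + g (snd z))"
    if "continuous_map P S g" for g
  proof -
    have "continuous_map (prod_topology P P) (prod_topology S S) (\<lambda>z. (g (fst z), g (snd z)))"
      by (intro continuous_map_pairedI continuous_map_compose[OF continuous_map_fst that, unfolded o_def]
          continuous_map_compose[OF continuous_map_snd that, unfolded o_def])
    from continuous_map_compose[OF this Sadd] show ?thesis by (simp add: o_def)
  qed
  have scale': "continuous_map (prod_topology euclidean P) S (\<lambda>z. seq_scale (fst z) (g (snd z)))"
    if "continuous_map P S g" for g
  proof -
    have "continuous_map (prod_topology euclidean P) (prod_topology euclidean S) (\<lambda>z. (fst z, g (snd z)))"
      by (intro continuous_map_pairedI continuous_map_fst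
          continuous_map_compose[OF continuous_map_snd that, unfolded o_def])
    from continuous_map_compose[OF this Sscale] show ?thesis by (simp add: o_def)
  qed
  show "lc_hausdorff P"
    unfolding lc_hausdorff_def
  proof (intro conjI allI impI)
    show "seq.subspace (topspace P)" using S top by (simp add: lc_hausdorff_def)
    show "continuous_map (prod_topology P P) P (\<lambda>(x, y). x + y)"
      unfolding case_prod_unfold
      by (rule into) (use add'[OF cid] add'[OF cT] add in simp_all)
    show "continuous_map (prod_topology euclidean P) P (\<lambda>(c, x). seq_scale c x)"
      unfolding case_prod_unfold
      by (rule into) (use scale'[OF cid] scale'[OF cT] scale in simp_all)
    show "Hausdorff_space P"
      using S finer unfolding lc_hausdorff_def Hausdorff_space_def top by metis
  next
    fix U assume U: "openin P U \<and> 0 \<in> U"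
    then obtain W where W: "openin (prod_topology S S) W" "U = (\<lambda>x. (x, T x)) -` W \<inter> topspace S"
      unfolding P_def openin_pullback_topology by blast
    have T0: "T 0 = 0" using scale[of 0 0] by (simp add: seq_scale_def zero_fun_def)
    have "(0, 0) \<in> W" using U W(2) T0 by auto
    then obtain A B where AB: "openin S A" "openin S B" "0 \<in> A" "0 \<in> B" "A \<times> B \<subseteq> W"
      using W(1) unfolding openin_prod_topology_alt by meson
    obtain A' where A': "openin S A'" "seq_convex A'" "0 \<in> A'" "A' \<subseteq> A"
      using S AB(1,3) unfolding lc_hausdorff_def by blast
    obtain B' where B': "openin S B'" "seq_convex B'" "0 \<in> B'" "B' \<subseteq> B"
      using S AB(2,4) unfolding lc_hausdorff_def by blast
    define V where "V = A' \<inter> {x \<in> topspace P. T x \<in> B'}"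
    have "openin P V"
      unfolding V_def using finer[OF A'(1)] openin_continuous_map_preimage[OF cT B'(1)] by blast
    moreover have "V \<subseteq> U"
      using A'(4) B'(4) AB(5) top unfolding V_def W(2) by (auto intro!: subsetD[OF AB(5)])
    moreover have "0 \<in> V"
      using A'(3) B'(3) T0 openin_subset[OF A'(1)] top unfolding V_def by auto
    moreover have "seq_convex V"
      unfolding seq_convex_def
    proof (intro ballI)
      fix x y and t :: real
      assume *: "x \<in> V" "y \<in> V" "t \<in> {0..1}"
      let ?z = "seq_scale (of_real (1 - t)) x + seq_scale (of_real t) y"
      have "?z \<in> A'" using * A'(2) unfolding V_def seq_convex_def by blast
      moreover have "T ?z \<in> B'"
        using * B'(2) unfolding V_def seq_convex_def add scale by blast
      ultimately show "?z \<in> V"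
        unfolding V_def top using openin_subset[OF A'(1)] by blast
    qed
    ultimately show "\<exists>V. openin P V \<and> seq_convex V \<and> 0 \<in> V \<and> V \<subseteq> U" by blast
  qed
qed

text \<open>
  This is the universal property of the inductive limit, for endomorphisms. If \<open>T\<close> is continuous on
  every step, the graph topology above is compatible with the steps, hence coarser than the
  inductive limit topology; being also finer, it coincides with it.
\<close>

lemma continuous_map_ind_limit:
  assumes S: "is_ind_limit X S" and T: "Vector_Spaces.linear seq_scale seq_scale T"
    and step: "\<And>k. continuous_map (X k) S T"
  shows "continuous_map S S T"
proof -
  have comp: "lc_hausdorff S" "topspace S = (\<Union>k. topspace (X k))"
    "\<And>k. continuous_map (X k) S (\<lambda>x. x)"
    using S by (simp_all add: is_ind_limit_def step_compatible_def)
  have maps: "T \<in> topspace S \<rightarrow> topspace S"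
    using step unfolding comp(2) continuous_map by blast
  define P where "P = pullback_topology (topspace S) (\<lambda>x. (x, T x)) (prod_topology S S)"
  note P = lc_hausdorff_graph_topology[OF comp(1) T maps, folded P_def]
  have "step_compatible X P"
    unfolding step_compatible_def using P(1,2) P(5)[OF comp(3) step] comp(2) by simp
  then have coarser: "openin S U" if "openin P U" for U
    using S that unfolding is_ind_limit_def by blast
  have "S = P"
    unfolding topology_eq using coarser P(4) by blast
  then show ?thesis using P(3) by simp
qed

lemma continuous_map_c0_bounded:
  assumes w: "\<And>n. w n > 0" and v: "\<And>n. v n > 0"
    and T: "Vector_Spaces.linear seq_scale seq_scale T"
    and maps: "\<And>x. x \<in> c0 w \<Longrightarrow> T x \<in> c0 v"
    and bound: "\<And>x n. x \<in> c0 w \<Longrightarrow> v n * norm (T x n) \<le> B * c0_norm w x"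
  shows "continuous_map (c0_topology w) (c0_topology v) T"
proof -
  interpret W: Metric_space "c0 w" "c0_dist w" by (rule Metric_space_c0[OF w])
  have "continuous_map W.mtopology (Metric_space.mtopology (c0 v) (c0_dist v)) T"
  proof (subst W.metric_continuous_map[OF Metric_space_c0[OF v]], intro conjI ballI allI impI)
    fix a and e :: real assume a: "a \<in> c0 w" and e: "e > 0"
    have "c0_dist v (T a) (T x) < e" if x: "x \<in> c0 w" "c0_dist w a x < e / (\<bar>B\<bar> + 1)" for x
    proof -
      have ax: "a - x \<in> c0 w" using a x c0_subspace[OF w] by (intro seq.subspace_diff)
      have pos: "0 \<le> c0_norm w (a - x)"
        using c0_le_norm[OF ax, of 0] w[of 0] by (meson norm_ge_zero mult_nonneg_nonneg order.trans less_imp_le)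
      have "T a - T x = T (a - x)"
        using module_hom.diff[OF T[folded module_hom_iff_linear]] by simp
      then have "c0_dist v (T a) (T x) = c0_norm v (T (a - x))"
        using maps a x by (simp add: c0_dist_def)
      also have "\<dots> \<le> B * c0_norm w (a - x)"
        unfolding c0_norm_def[of v] by (rule cSUP_least) (auto intro: bound[OF ax])
      also have "\<dots> \<le> (\<bar>B\<bar> + 1) * c0_norm w (a - x)"
        using pos by (intro mult_right_mono) auto
      also have "\<dots> < e"
        using x a by (simp add: c0_dist_def field_simps)
      finally show ?thesis .
    qed
    then show "\<exists>d>0. \<forall>x. x \<in> c0 w \<and> c0_dist w a x < d \<longrightarrow> c0_dist v (T a) (T x) < e"
      using e by (intro exI[of _ "e / (\<bar>B\<bar> + 1)"]) (auto intro: divide_pos_pos)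
  qed (use maps in auto)
  then show ?thesis by (simp add: c0_topology_def)
qed

section \<open>Continuous operators of the limit space\<close>

locale coechelon =
  fixes \<alpha> s :: "nat \<Rightarrow> real"
  assumes \<alpha>_pos: "\<And>n. 0 < \<alpha> n" and \<alpha>_mono: "strict_mono \<alpha>"
    and \<alpha>_top: "filterlim \<alpha> at_top sequentially"
    and s_mono: "strict_mono s" and s_gt1: "\<And>k. 1 < s k"
    and s_top: "filterlim s at_top sequentially"
begin

abbreviation v :: "nat \<Rightarrow> nat \<Rightarrow> real" where "v \<equiv> weight \<alpha> s"

lemma v_pos: "v k n > 0"
  using s_gt1[of k] by (simp add: weight_def)

lemma v_antimono: "m \<le> n \<Longrightarrow> v k n \<le> v k m"
  unfolding weight_def using s_gt1[of k] strict_mono_leD[OF \<alpha>_mono]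
  by (intro powr_mono) auto

lemma topspace_E: "topspace (E_space \<alpha> s) = (\<Union>k. c0 (v k))"
  by (rule E_space_is_ind_limit(2)[OF \<alpha>_pos s_mono s_gt1])

text \<open>
  The quotient \<open>v (Suc k) n / v k n\<close> is the \<open>\<alpha> n\<close>-th power of a number below 1 and so tends to 0.
  Thus mere boundedness with respect to one weight gives membership in the next step.
\<close>

lemma bounded_imp_c0_Suc:
  assumes "\<And>n. v k n * norm (x n) \<le> B" shows "x \<in> c0 (v (Suc k))"
proof -
  define q where "q = s k / s (Suc k)"
  have q: "0 < q" "q < 1"
    using s_gt1[of k] s_gt1[of "Suc k"] strict_monoD[OF s_mono, of k "Suc k"] by (auto simp: q_def)
  have vq: "v (Suc k) n = q powr \<alpha> n * v k n" for n
    using s_gt1[of k] s_gt1[of "Suc k"]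
    by (simp add: weight_def q_def powr_divide powr_minus field_simps)
  have "((\<lambda>n. q powr \<alpha> n) \<longlongrightarrow> 0) sequentially"
  proof -
    have "filterlim (\<lambda>n. \<alpha> n * - ln q) at_top sequentially"
      using q by (intro filterlim_at_top_mult_tendsto_pos[OF tendsto_const _ \<alpha>_top]) auto
    then have "filterlim (\<lambda>n. - (\<alpha> n * - ln q)) at_bot sequentially"
      by (simp only: filterlim_uminus_at_top)
    then have "((\<lambda>n. exp (- (\<alpha> n * - ln q))) \<longlongrightarrow> 0) sequentially"
      by (rule filterlim_compose[OF exp_at_bot])
    then show ?thesis using q by (simp add: powr_def)
  qed
  then have lim: "(\<lambda>n. q powr \<alpha> n * B) \<longlonglongrightarrow> 0"
    by (rule tendsto_mult_left_zero)
  have "norm (v (Suc k) n * norm (x n)) \<le> q powr \<alpha> n * B" for n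
    using assms[of n] v_pos[of "Suc k" n]
    by (simp add: abs_mult) (simp add: vq mult.assoc mult_left_mono)
  then have "(\<lambda>n. v (Suc k) n * norm (x n)) \<longlonglongrightarrow> 0"
    by (intro Lim_null_comparison[OF _ lim] always_eventually allI)
  then show ?thesis by (simp add: c0_def)
qed

text \<open>
  Continuity on the limit space thus reduces to one supremum estimate per step; the decay of the
  image, which membership in a step requires, comes for free by moving one step further.
\<close>

lemma stepwise_bounded_op:
  assumes T: "Vector_Spaces.linear seq_scale seq_scale T"
    and bound: "\<And>k. \<exists>l B. \<forall>x\<in>c0 (v k). \<forall>n. v l n * norm (T x n) \<le> B * c0_norm (v k) x"
  shows "T \<in> cont_linear_ops (E_space \<alpha> s)"
proof -
  note E = E_space_is_ind_limit(1)[OF \<alpha>_pos s_mono s_gt1]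
  have "continuous_map (E_space \<alpha> s) (E_space \<alpha> s) T"
  proof (rule continuous_map_ind_limit[OF E T])
    fix k
    obtain l B where B: "\<And>x n. x \<in> c0 (v k) \<Longrightarrow> v l n * norm (T x n) \<le> B * c0_norm (v k) x"
      using bound[of k] by blast
    have le: "v (Suc l) n \<le> v l n" for n
      unfolding weight_def using \<alpha>_pos[of n] s_gt1[of l] strict_monoD[OF s_mono, of l "Suc l"]
      by (intro powr_mono2') auto
    have "continuous_map (c0_topology (v k)) (c0_topology (v (Suc l))) T"
    proof (rule continuous_map_c0_bounded[OF v_pos v_pos T])
      show "T x \<in> c0 (v (Suc l))" if "x \<in> c0 (v k)" for x
        by (rule bounded_imp_c0_Suc[OF B[OF that]])
      show "v (Suc l) n * norm (T x n) \<le> B * c0_norm (v k) x" if "x \<in> c0 (v k)" for x n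
        using mult_right_mono[OF le, of "norm (T x n)" n] B[OF that, of n] by simp
    qed
    moreover have "continuous_map (c0_topology (v (Suc l))) (E_space \<alpha> s) (\<lambda>x. x)"
      using E by (simp add: is_ind_limit_def step_compatible_def)
    ultimately show "continuous_map (c0_topology (v k)) (E_space \<alpha> s) T"
      using continuous_map_compose by (fastforce simp: o_def)
  qed
  with T show ?thesis by (simp add: cont_linear_ops_def Vector_Spaces.linear_iff)
qed

end

section \<open>The Cesaro operator and its algebraic inverse\<close>

text \<open>At \<open>n = 0\<close> the truncated index is harmless, as its coefficient vanishes.\<close>

definition inv_cesaro :: "cseq \<Rightarrow> cseq" where
  "inv_cesaro y = (\<lambda>n. of_nat (Suc n) * y n - of_nat n * y (n - 1))"

lemma cesaro_inv_cesaro: "cesaro (inv_cesaro y) = y"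
proof -
  have "(\<Sum>i\<le>n. inv_cesaro y i) = of_nat (Suc n) * y n" for n
    by (induction n) (simp_all add: inv_cesaro_def algebra_simps)
  moreover have "of_nat (Suc n) \<noteq> (0 :: complex)" for n by (simp only: of_nat_eq_0_iff)
  ultimately show ?thesis by (simp add: cesaro_def fun_eq_iff del: of_nat_Suc)
qed

lemma inv_cesaro_cesaro: "inv_cesaro (cesaro x) = x"
proof
  have nz: "of_nat (Suc n) \<noteq> (0 :: complex)" for n by (simp only: of_nat_eq_0_iff)
  show "inv_cesaro (cesaro x) n = x n" for n
    by (cases n) (simp_all add: inv_cesaro_def cesaro_def nz del: of_nat_Suc)
qed

lemma linear_cesaro: "Vector_Spaces.linear seq_scale seq_scale cesaro"
  using seq.vector_space_axioms
  by (auto simp: Vector_Spaces.linear_iff cesaro_def seq_scale_def fun_eq_iff sum.distrib add_divide_distrib sum_distrib_left)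

lemma linear_inv_cesaro: "Vector_Spaces.linear seq_scale seq_scale inv_cesaro"
  using seq.vector_space_axioms
  by (auto simp: Vector_Spaces.linear_iff inv_cesaro_def seq_scale_def fun_eq_iff algebra_simps)

text \<open>Hence the resolvent of the Cesaro operator at 0 can only be the negative of \<open>inv_cesaro\<close>.\<close>

lemma zero_in_resolvent_set_cesaro:
  assumes "inv_cesaro \<in> cont_linear_ops X" "cesaro \<in> cont_linear_ops X"
    and lc: "lc_hausdorff X"
  shows "0 \<in> resolvent_set cesaro X"
proof -
  have neg: "seq_scale (- 1) x = - x" for x by (simp add: seq_scale_def fun_eq_iff)
  have zero: "seq_scale 0 x = 0" for x by (simp add: seq_scale_def fun_eq_iff)
  let ?R = "\<lambda>x. seq_scale (- 1) (inv_cesaro x)"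
  have "continuous_map X (prod_topology euclidean X) (\<lambda>x. (- 1 :: complex, inv_cesaro x))"
    using assms(1) by (intro continuous_map_pairedI) (simp_all add: cont_linear_ops_def)
  moreover have "continuous_map (prod_topology (euclidean :: complex topology) X) X (\<lambda>(c, x). seq_scale c x)"
    using lc by (simp add: lc_hausdorff_def)
  ultimately have "continuous_map X X ?R"
    using continuous_map_compose by (fastforce simp: o_def)
  moreover have "?R (x + y) = ?R x + ?R y" "?R (seq_scale c x) = seq_scale c (?R x)" for c x y
    using linear_inv_cesaro by (simp_all add: Vector_Spaces.linear_iff seq.scale_right_distrib mult.commute)
  ultimately have "?R \<in> cont_linear_ops X" by (simp add: cont_linear_ops_def)
  moreover have "?R (seq_scale 0 x - cesaro x) = x" "seq_scale 0 (?R x) - cesaro (?R x) = x" for x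
  proof -
    have "inv_cesaro (- x) = - inv_cesaro x" "cesaro (- x) = - cesaro x" for x
      by (simp_all add: inv_cesaro_def cesaro_def fun_eq_iff sum_negf)
    then show "?R (seq_scale 0 x - cesaro x) = x" "seq_scale 0 (?R x) - cesaro (?R x) = x"
      unfolding neg zero by (simp_all add: cesaro_inv_cesaro inv_cesaro_cesaro)
  qed
  ultimately show ?thesis
    unfolding resolvent_set_def by (intro CollectI bexI[of _ ?R]) auto
qed

lemma resolvent_set_cesaro_imp_inv_cesaro:
  assumes "0 \<in> resolvent_set cesaro X" "lc_hausdorff X" "x \<in> topspace X"
  shows "inv_cesaro x \<in> topspace X"
proof -
  obtain R where R: "R \<in> cont_linear_ops X" "seq_scale 0 (R x) - cesaro (R x) = x"
    using assms unfolding resolvent_set_def by blast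
  have "x = - cesaro (R x)" using R(2) by (simp add: seq_scale_def fun_eq_iff)
  also have "\<dots> = cesaro (- R x)" by (simp add: cesaro_def fun_eq_iff sum_negf)
  finally have "inv_cesaro x = - R x" by (metis inv_cesaro_cesaro)
  moreover have "R x \<in> topspace X"
    using R(1) assms(3) by (auto simp: cont_linear_ops_def continuous_map)
  ultimately show ?thesis
    using assms(2) seq.subspace_neg by (simp add: lc_hausdorff_def)
qed

section \<open>Continuity of both operators and the growth condition\<close>

context coechelon
begin

text \<open>
  Since the weight decreases, its product with the n-th mean is at most the n-th mean of the
  products, so the Cesaro operator does not increase the norm of any step.
\<close>

lemma cesaro_op: "cesaro \<in> cont_linear_ops (E_space \<alpha> s)"
proof (rule stepwise_bounded_op[OF linear_cesaro], intro exI ballI allI)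
  fix k x n assume x: "x \<in> c0 (v k)"
  have "v k n * norm (cesaro x n) = v k n * norm (\<Sum>i\<le>n. x i) / real (Suc n)"
    by (simp add: cesaro_def norm_divide del: of_nat_Suc)
  also have "\<dots> \<le> v k n * (\<Sum>i\<le>n. norm (x i)) / real (Suc n)"
    using v_pos[of k n] by (intro divide_right_mono mult_left_mono norm_sum) auto
  also have "v k n * (\<Sum>i\<le>n. norm (x i)) \<le> (\<Sum>i\<le>n. v k i * norm (x i))"
    unfolding sum_distrib_left by (intro sum_mono mult_right_mono v_antimono) auto
  also have "\<dots> \<le> (\<Sum>i\<le>n. c0_norm (v k) x)"
    by (intro sum_mono c0_le_norm x)
  also have "\<dots> = real (Suc n) * c0_norm (v k) x" by simp
  finally show "v k n * norm (cesaro x n) \<le> 1 * c0_norm (v k) x"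
    by (simp add: divide_right_mono del: of_nat_Suc)
qed

lemma inv_cesaro_op:
  assumes M: "\<And>n. ln (real (Suc n)) / \<alpha> n \<le> M"
  shows "inv_cesaro \<in> cont_linear_ops (E_space \<alpha> s)"
proof (rule stepwise_bounded_op[OF linear_inv_cesaro])
  fix k
  obtain l where l: "exp M * s k \<le> s l"
    using s_top unfolding filterlim_at_top eventually_sequentially by blast
  \<comment> \<open>The gap between the bases \<open>s k\<close> and \<open>s l\<close> absorbs the factor \<open>Suc n\<close>.\<close>
  have absorb: "real (Suc n) * v l n \<le> v k n" for n
  proof -
    have "ln (real (Suc n)) \<le> M * \<alpha> n"
      using M[of n] \<alpha>_pos[of n] by (simp add: pos_divide_le_eq)
    then have "real (Suc n) \<le> exp M powr \<alpha> n"
      by (simp add: powr_def mult.commute del: of_nat_Suc)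
         (metis exp_le_cancel_iff exp_ln of_nat_0_less_iff zero_less_Suc)
    moreover have "v l n \<le> (exp M * s k) powr (- \<alpha> n)"
      unfolding weight_def using l \<alpha>_pos[of n] s_gt1[of k] by (intro powr_mono2') auto
    ultimately have "real (Suc n) * v l n \<le> exp M powr \<alpha> n * (exp M * s k) powr (- \<alpha> n)"
      using v_pos[of l n] by (intro mult_mono) auto
    also have "\<dots> = v k n"
      using s_gt1[of k] by (simp add: weight_def powr_mult powr_minus)
    finally show ?thesis .
  qed
  have "v l n * norm (inv_cesaro y n) \<le> 2 * c0_norm (v k) y" if y: "y \<in> c0 (v k)" for y n
  proof -
    have "norm (inv_cesaro y n) \<le> real (Suc n) * norm (y n) + real n * norm (y (n - 1))"
      unfolding inv_cesaro_def by (rule order.trans[OF norm_triangle_ineq4]) (simp add: norm_mult del: of_nat_Suc)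
    also have "\<dots> \<le> real (Suc n) * norm (y n) + real (Suc n) * norm (y (n - 1))"
      by (simp add: mult_right_mono)
    finally have "v l n * norm (inv_cesaro y n)
        \<le> v l n * (real (Suc n) * norm (y n) + real (Suc n) * norm (y (n - 1)))"
      using v_pos[of l n] by (intro mult_left_mono) auto
    also have "\<dots> = (real (Suc n) * v l n) * norm (y n) + (real (Suc n) * v l n) * norm (y (n - 1))"
      by (simp add: algebra_simps)
    also have "\<dots> \<le> v k n * norm (y n) + v k n * norm (y (n - 1))"
      by (intro add_mono mult_right_mono absorb) auto
    also have "\<dots> \<le> v k n * norm (y n) + v k (n - 1) * norm (y (n - 1))"
      by (intro add_left_mono mult_right_mono v_antimono) auto
    also have "\<dots> \<le> c0_norm (v k) y + c0_norm (v k) y"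
      by (intro add_mono c0_le_norm y)
    finally show ?thesis by simp
  qed
  then show "\<exists>l B. \<forall>x\<in>c0 (v k). \<forall>n. v l n * norm (inv_cesaro x n) \<le> B * c0_norm (v k) x"
    by blast
qed

text \<open>
  The test sequence is \<open>(-1)\<^sup>n\<close>: alternating signs turn the weighted difference into a sum, so
  the image of this bounded sequence grows linearly, and the growth must be dominated by one of
  the weights.
\<close>

lemma inv_cesaro_invariant_imp_bounded:
  assumes inv: "\<And>x. x \<in> topspace (E_space \<alpha> s) \<Longrightarrow> inv_cesaro x \<in> topspace (E_space \<alpha> s)"
  shows "\<exists>M. \<forall>n. ln (real (Suc n)) / \<alpha> n \<le> M"
proof -
  define x :: cseq where "x = (\<lambda>n. (- 1) ^ n)"
  have "v 0 n * norm (x n) \<le> 1" for n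
    using s_gt1[of 0] \<alpha>_pos[of n] by (simp add: x_def weight_def norm_power powr_minus ge_one_powr_ge_zero inverse_le_1_iff less_imp_le)
  then have "x \<in> topspace (E_space \<alpha> s)"
    unfolding topspace_E using bounded_imp_c0_Suc by blast
  from inv[OF this] obtain k where k: "inv_cesaro x \<in> c0 (v k)"
    unfolding topspace_E by blast
  have grow: "real (Suc n) \<le> norm (inv_cesaro x n)" for n
  proof (cases n)
    case (Suc m)
    have "inv_cesaro x n = of_nat (Suc n + n) * (- 1) ^ n"
      by (simp add: inv_cesaro_def x_def Suc algebra_simps)
    then have "norm (inv_cesaro x n) = real (Suc n + n)"
      by (simp add: norm_mult norm_power del: of_nat_Suc of_nat_add)
    then show ?thesis by simp
  qed (simp add: inv_cesaro_def x_def)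
  define K where "K = max 1 (c0_norm (v k) (inv_cesaro x))"
  have K: "K \<ge> 1" by (simp add: K_def)
  have "ln (real (Suc n)) / \<alpha> n \<le> ln K / \<alpha> 0 + ln (s k)" for n
  proof -
    have "v k n * real (Suc n) \<le> v k n * norm (inv_cesaro x n)"
      using grow v_pos[of k n] by (intro mult_left_mono) auto
    also have "\<dots> \<le> K" using c0_le_norm[OF k, of n] by (simp add: K_def)
    finally have "real (Suc n) \<le> K * s k powr \<alpha> n"
      using s_gt1[of k] by (simp add: weight_def powr_minus field_simps)
    then have "ln (real (Suc n)) \<le> ln (K * s k powr \<alpha> n)"
      using K s_gt1[of k] by (subst ln_le_cancel_iff) auto
    also have "\<dots> = ln K + \<alpha> n * ln (s k)"
      using K s_gt1[of k] by (simp add: ln_mult ln_powr)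
    finally have "ln (real (Suc n)) / \<alpha> n \<le> ln K / \<alpha> n + ln (s k)"
      using \<alpha>_pos[of n] by (simp add: field_simps)
    also have "ln K / \<alpha> n \<le> ln K / \<alpha> 0"
      using K \<alpha>_pos strict_mono_leD[OF \<alpha>_mono, of 0 n] by (intro divide_left_mono) auto
    finally show ?thesis by simp
  qed
  then show ?thesis by blast
qed

end

theorem proposition2p4:
  fixes \<alpha> s :: "nat \<Rightarrow> real"
  assumes "\<And>n. 0 < \<alpha> n" and "strict_mono \<alpha>" and "filterlim \<alpha> at_top sequentially"
    and "strict_mono s" and "\<And>k. 1 < s k" and "filterlim s at_top sequentially"
  shows "(SUP n. ereal (ln (real (Suc n)) / \<alpha> n)) < \<infinity> \<longleftrightarrow>
         cesaro \<in> cont_linear_ops (E_space \<alpha> s) \<and> 0 \<in> resolvent_set cesaro (E_space \<alpha> s)"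
proof -
  interpret coechelon \<alpha> s using assms by unfold_locales
  have lc: "lc_hausdorff (E_space \<alpha> s)"
    using E_space_is_ind_limit(1)[of \<alpha> s] assms by (simp add: is_ind_limit_def step_compatible_def)
  show ?thesis
  proof
    assume "(SUP n. ereal (ln (real (Suc n)) / \<alpha> n)) < \<infinity>"
    then obtain N :: nat where "(SUP n. ereal (ln (real (Suc n)) / \<alpha> n)) < ereal (real N)"
      using less_PInf_Ex_of_nat by auto
    then have "ereal (ln (real (Suc n)) / \<alpha> n) \<le> ereal (real N)" for n
      by (meson SUP_upper UNIV_I less_imp_le order.trans)
    then have "inv_cesaro \<in> cont_linear_ops (E_space \<alpha> s)"
      by (intro inv_cesaro_op[of "real N"]) simp
    then show "cesaro \<in> cont_linear_ops (E_space \<alpha> s) \<and> 0 \<in> resolvent_set cesaro (E_space \<alpha> s)"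
      using cesaro_op zero_in_resolvent_set_cesaro[OF _ _ lc] by blast
  next
    assume "cesaro \<in> cont_linear_ops (E_space \<alpha> s) \<and> 0 \<in> resolvent_set cesaro (E_space \<alpha> s)"
    then obtain M where "\<forall>n. ln (real (Suc n)) / \<alpha> n \<le> M"
      using inv_cesaro_invariant_imp_bounded resolvent_set_cesaro_imp_inv_cesaro[OF _ lc] by blast
    then have "(SUP n. ereal (ln (real (Suc n)) / \<alpha> n)) \<le> ereal M"
      by (intro SUP_least) simp
    then show "(SUP n. ereal (ln (real (Suc n)) / \<alpha> n)) < \<infinity>"
      by (rule le_less_trans) simp
  qed
qed

end
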